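(* Let $\mathbf A=(A,R,{}')$ be a directed relational system with involution and $|$ a Sheffer operation assigned to $\mathbf A$. Then $R$ is symmetric if and only if $((x|y)|(x|y))|x=x|x$ for all $x,y\in A$.
   Context: For a binary relation $R$ on a non-empty set $A$ and $a,b\in A$, let $U(a,b):=\{x\in A\mid (a,x),(b,x)\in R\}$ and $L(a,b):=\{x\in A\mid (x,a),(x,b)\in R\}$. A directed relational system with involution is a triple $(A,R,{}')$ where $A$ is a non-empty set, $R$ is a reflexive binary relation on $A$, $U(x,y)\neq\emptyset$ and $L(x,y)\neq\emptyset$ for all $x,y\in A$, and $'$ is a unary operation on $A$ such that $x''=x$ for all $x\in A$ and $(x,y)\in R$ implies $(y',x')\in R$ for all $x,y\in A$. A Sheffer operation assigned to $\mathbf A=(A,R,{}')$ is a binary operation $|$ on $A$ such that for all $x,y\in A$: $x|y=y'$ if $(x',y')\in R$, and $x|y$ is an (arbitrary) element of $U(x',y')$ otherwise. (Every such operation satisfies $(x|y)|(x|x)=x$ and $(x|y)|(y|y)=y$ for all $x,y\in A$.) *)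

theory Defs
  imports Main
begin

definition upper_cone :: "'a set \<Rightarrow> 'a rel \<Rightarrow> 'a \<Rightarrow> 'a \<Rightarrow> 'a set" where
  "upper_cone A R a b = {x \<in> A. (a, x) \<in> R \<and> (b, x) \<in> R}"

definition lower_cone :: "'a set \<Rightarrow> 'a rel \<Rightarrow> 'a \<Rightarrow> 'a \<Rightarrow> 'a set" where
  "lower_cone A R a b = {x \<in> A. (x, a) \<in> R \<and> (x, b) \<in> R}"

(* refl_on does not entail R \<subseteq> A \<times> A, so this is a separate axiom.
   Operations on A are total HOL functions under which A is closed; their values outside A are
   irrelevant. *)
locale directed_relational_system_with_involution =
  fixes A :: "'a set" and R :: "'a rel" and invol :: "'a \<Rightarrow> 'a"
  assumes nonempty: "A \<noteq> {}"
    and rel_on: "R \<subseteq> A \<times> A"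
    and reflexive: "refl_on A R"
    and upper_directed: "\<forall>x\<in>A. \<forall>y\<in>A. upper_cone A R x y \<noteq> {}"
    and lower_directed: "\<forall>x\<in>A. \<forall>y\<in>A. lower_cone A R x y \<noteq> {}"
    and inv_closed: "\<forall>x\<in>A. invol x \<in> A"
    and involutive: "\<forall>x\<in>A. invol (invol x) = x"
    and antitone: "\<forall>x\<in>A. \<forall>y\<in>A. (x, y) \<in> R \<longrightarrow> (invol y, invol x) \<in> R"

definition sheffer_operation ::
  "'a set \<Rightarrow> 'a rel \<Rightarrow> ('a \<Rightarrow> 'a) \<Rightarrow> ('a \<Rightarrow> 'a \<Rightarrow> 'a) \<Rightarrow> bool" where
  "sheffer_operation A R invol s \<longleftrightarrow>
     (\<forall>x\<in>A. \<forall>y\<in>A. s x y \<in> A) \<and>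
     (\<forall>x\<in>A. \<forall>y\<in>A.
        if (invol x, invol y) \<in> R then s x y = invol y
        else s x y \<in> upper_cone A R (invol x) (invol y))"

end

theory Submission
  imports Defs
begin

text \<open>The identity is a statement about \<open>R\<close> in disguise. Since \<open>x | y = y'\<close> holds exactly when
  \<open>(x', y') \<in> R\<close> (lemma \<open>sheffer_eq_invol_iff\<close>), and \<open>z | z = z'\<close> for every \<open>z\<close>, the identity at
  \<open>x\<close>, \<open>y\<close> reads \<open>(x | y)' | x = x'\<close>, that is, \<open>(x | y, x') \<in> R\<close>. On the other hand, a
  Sheffer operation always gives the reverse pair \<open>(x', x | y) \<in> R\<close>, and every pair
  \<open>(a, b) \<in> R\<close> has this form: take \<open>x = a'\<close> and \<open>y = b'\<close>, so that \<open>x | y = b\<close>. Hence the identity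
  reverses precisely the pairs of \<open>R\<close>.\<close>

text \<open>If \<open>(x', y') \<notin> R\<close>, then \<open>x | y\<close> is an upper bound of \<open>x'\<close>, which \<open>y'\<close> is not; so the value
  \<open>y'\<close> occurs only in the case where it is prescribed.\<close>

lemma sheffer_eq_invol_iff:
  assumes "sheffer_operation A R invol s" "x \<in> A" "y \<in> A"
  shows "s x y = invol y \<longleftrightarrow> (invol x, invol y) \<in> R"
  using assms unfolding sheffer_operation_def upper_cone_def
  by (metis (no_types, lifting) mem_Collect_eq)

lemma invol_sheffer_related:
  assumes "sheffer_operation A R invol s" "x \<in> A" "y \<in> A"
  shows "(invol x, s x y) \<in> R"
  using assms unfolding sheffer_operation_def upper_cone_def
  by (metis (no_types, lifting) mem_Collect_eq)

theorem theorem4p1: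
  fixes A :: "'a set" and R :: "'a rel" and invol :: "'a \<Rightarrow> 'a" and s :: "'a \<Rightarrow> 'a \<Rightarrow> 'a"
  assumes "directed_relational_system_with_involution A R invol"
    and "sheffer_operation A R invol s"
  shows "sym R \<longleftrightarrow> (\<forall>x\<in>A. \<forall>y\<in>A. s (s (s x y) (s x y)) x = s x x)"
proof -
  interpret directed_relational_system_with_involution A R invol by (fact assms(1))
  note sheffer = assms(2)
  have closed: "s x y \<in> A" if "x \<in> A" "y \<in> A" for x y
    using sheffer that unfolding sheffer_operation_def by blast
  have diagonal: "s z z = invol z" if "z \<in> A" for z
    using sheffer_eq_invol_iff[OF sheffer that that] reflexive inv_closed that
    by (auto dest: refl_onD)
  have identity_iff: "s (s (s x y) (s x y)) x = s x x \<longleftrightarrow> (s x y, invol x) \<in> R"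
    if "x \<in> A" "y \<in> A" for x y
    using sheffer_eq_invol_iff[OF sheffer, of "invol (s x y)" x] closed[OF that] that
    by (simp add: diagonal inv_closed involutive)
  show ?thesis
  proof
    assume "sym R"
    then show "\<forall>x\<in>A. \<forall>y\<in>A. s (s (s x y) (s x y)) x = s x x"
      using identity_iff invol_sheffer_related[OF sheffer] by (blast dest: symD)
  next
    assume identity: "\<forall>x\<in>A. \<forall>y\<in>A. s (s (s x y) (s x y)) x = s x x"
    show "sym R"
    proof (rule symI)
      fix a b assume ab: "(a, b) \<in> R"
      then have in_A: "a \<in> A" "b \<in> A" using rel_on by auto
      have "s (invol a) (invol b) = b"
        using sheffer_eq_invol_iff[OF sheffer, of "invol a" "invol b"] ab in_A
        by (simp add: inv_closed involutive)
      moreover have "(s (invol a) (invol b), invol (invol a)) \<in> R"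
        using identity identity_iff in_A inv_closed by blast
      ultimately show "(b, a) \<in> R" using in_A by (simp add: involutive)
    qed
  qed
qed

end
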